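(* $$\int_0^1 \log\Gamma(x+1)\cot(\pi x)\,dx=\sum_{n=1}^{\infty}\frac{Ci(2n\pi)}{n\pi}.$$
   Context: $\Gamma$ is the gamma function and $\log$ is the natural logarithm. The cosine integral is defined for $x>0$ by $$Ci(x)=-\int_x^\infty\frac{\cos t}{t}\,dt=\gamma+\log x+\int_0^x\frac{\cos t-1}{t}\,dt,$$ where $\gamma$ is Euler's constant. *)

theory Defs
  imports "HOL-Analysis.Analysis"
begin

text \<open>
  The integral of \<open>cos t / t\<close> over \<open>[x, \<infinity>)\<close> converges only conditionally, hence the explicit
  limit of integrals over compact intervals. Only the values at \<open>x > 0\<close> are meaningful.
\<close>

definition Ci :: "real \<Rightarrow> real" where
  "Ci x = - Lim at_top (\<lambda>T. integral {x..T} (\<lambda>t. cos t / t))"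

end

theory Submission imports Defs
begin

text \<open>
  The idea is to expand the cotangent into its divergent Fourier series
  \<open>cot (\<pi> x) = 2 \<Sum>n\<ge>1. sin (2 \<pi> n x)\<close> and to integrate against
  \<open>log \<Gamma>(x + 1)\<close> term by term. Two facts make this rigorous.

  Truncating the series after \<open>M\<close> terms leaves exactly the remainder
  \<open>cos ((2 M + 1) \<pi> x) / sin (\<pi> x)\<close> (lemma \<open>cot_eq_sum_sin\<close>). Since
  \<open>log \<Gamma>(x + 1)\<close> vanishes at both \<open>0\<close> and \<open>1\<close>, the quotient
  \<open>log \<Gamma>(x + 1) / sin (\<pi> x)\<close> extends continuously to \<open>[0, 1]\<close>
  (lemma \<open>ln_Gamma_over_sin_extends\<close>), so the Riemann--Lebesgue lemma sends the contribution
  of the remainder to \<open>0\<close>. This yields integrability, and convergence of the series to the integral.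

  The individual terms are sine coefficients of \<open>log \<Gamma>(x + 1)\<close>. Integrating by parts turns
  them into cosine coefficients of the digamma function \<open>\<psi>(x + 1)\<close>. The recurrence
  \<open>\<psi>(y + 1) = \<psi>(y) + 1 / y\<close> together with the periodicity of the cosine shows that shifting
  \<open>\<psi>\<close> by \<open>N\<close> adds the integral of \<open>cos t / t\<close> over \<open>N\<close> periods of length
  \<open>2 \<pi> n\<close>. After the shift \<open>\<psi>\<close> varies by at most \<open>1 / (N + 1)\<close> over the unit
  interval, so its cosine coefficient tends to \<open>0\<close>; hence the unshifted coefficient is minus the
  integral of \<open>cos t / t\<close> over \<open>[2 \<pi> n, \<infinity>)\<close>, which is \<open>Ci (2 \<pi> n)\<close>
  (lemma \<open>Ci_eq_integral_Digamma_cos\<close>). This argument also proves that the improper integral converges.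
\<close>

section \<open>The Riemann--Lebesgue lemma for continuous functions\<close>

lemma integral_by_parts_continuous:
  fixes f g f' g' :: "real \<Rightarrow> real"
  assumes "a \<le> b"
    and f: "\<And>x. x \<in> {a..b} \<Longrightarrow> (f has_real_derivative f' x) (at x)"
    and g: "\<And>x. x \<in> {a..b} \<Longrightarrow> (g has_real_derivative g' x) (at x)"
    and f': "continuous_on {a..b} f'" and g': "continuous_on {a..b} g'"
  shows "integral {a..b} (\<lambda>x. f x * g' x) = f b * g b - f a * g a - integral {a..b} (\<lambda>x. f' x * g x)"
proof -
  have cont: "continuous_on {a..b} f" "continuous_on {a..b} g"
    using f g by (meson DERIV_isCont continuous_at_imp_continuous_on)+
  have "((\<lambda>x. f x * g' x + f' x * g x) has_integral (f b * g b - f a * g a)) {a..b}"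
  proof (rule fundamental_theorem_of_calculus[OF \<open>a \<le> b\<close>])
    fix x assume "x \<in> {a..b}"
    then have "((\<lambda>x. f x * g x) has_real_derivative f x * g' x + f' x * g x) (at x)"
      using DERIV_mult[OF f g] by (simp add: algebra_simps)
    then show "((\<lambda>x. f x * g x) has_vector_derivative f x * g' x + f' x * g x) (at x within {a..b})"
      by (simp add: has_real_derivative_iff_has_vector_derivative has_vector_derivative_at_within)
  qed
  moreover have "integral {a..b} (\<lambda>x. f x * g' x + f' x * g x)
      = integral {a..b} (\<lambda>x. f x * g' x) + integral {a..b} (\<lambda>x. f' x * g x)"
    by (intro integral_add integrable_continuous_real continuous_intros cont f' g')
  ultimately show ?thesis
    by (simp add: integral_unique)
qed

text \<open>
  For a polynomial, one integration by parts gains a factor \<open>1 / l\<close>; the Weierstrass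
  approximation theorem carries the conclusion over to continuous functions.
\<close>

lemma Riemann_Lebesgue_cos:
  fixes f :: "real \<Rightarrow> real"
  assumes "a \<le> b" and f: "continuous_on {a..b} f"
  shows "((\<lambda>l. integral {a..b} (\<lambda>x. f x * cos (l * x))) \<longlongrightarrow> 0) at_top"
proof (rule tendstoI)
  fix e :: real assume "e > 0"
  (* the approximation error contributes at most d * (b - a), hence at most e / 2; the summand 1 covers the case a = b *)
  define d where "d = e / (2 * (b - a + 1))"
  have "d > 0" using \<open>e > 0\<close> \<open>a \<le> b\<close> by (simp add: d_def)
  obtain p where p: "real_polynomial_function p" "\<And>x. x \<in> {a..b} \<Longrightarrow> \<bar>f x - p x\<bar> < d"
    using Stone_Weierstrass_real_polynomial_function[OF compact_Icc f \<open>d > 0\<close>] by blast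
  obtain p' where p': "real_polynomial_function p'"
      and deriv: "\<And>x. (p has_real_derivative p' x) (at x)"
    using has_real_derivative_polynomial_function[OF p(1)] by blast
  have cont [continuous_intros]: "continuous_on {a..b} p" "continuous_on {a..b} p'"
    using p(1) p' by (auto simp: real_polynomial_function_eq intro: continuous_on_polymonial_function)
  define C where "C = \<bar>p b\<bar> + \<bar>p a\<bar> + integral {a..b} (\<lambda>x. \<bar>p' x\<bar>)"
  have small: "\<bar>integral {a..b} (\<lambda>x. f x * cos (l * x))\<bar> \<le> e / 2 + C / l" if "l > 0" for l
  proof -
    have parts: "integral {a..b} (\<lambda>x. p x * (l * cos (l * x)))
        = p b * sin (l * b) - p a * sin (l * a) - integral {a..b} (\<lambda>x. p' x * sin (l * x))"
      by (rule integral_by_parts_continuous[OF \<open>a \<le> b\<close> deriv])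
         (auto intro!: derivative_eq_intros continuous_intros)
    have "\<bar>integral {a..b} (\<lambda>x. p' x * sin (l * x))\<bar> \<le> integral {a..b} (\<lambda>x. \<bar>p' x\<bar>)"
      unfolding real_norm_def[symmetric]
      by (rule integral_norm_bound_integral)
         (auto intro!: integrable_continuous_real continuous_intros
               simp: abs_mult mult_left_le)
    moreover have "\<bar>p b * sin (l * b)\<bar> \<le> \<bar>p b\<bar>" "\<bar>p a * sin (l * a)\<bar> \<le> \<bar>p a\<bar>"
      by (auto simp: abs_mult mult_left_le)
    moreover have "integral {a..b} (\<lambda>x. p x * (l * cos (l * x)))
        = l * integral {a..b} (\<lambda>x. p x * cos (l * x))"
      by (subst integral_mult_right[symmetric]) (simp add: mult_ac)
    ultimately have "l * \<bar>integral {a..b} (\<lambda>x. p x * cos (l * x))\<bar> \<le> C"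
      using parts \<open>l > 0\<close> abs_mult[of l "integral {a..b} (\<lambda>x. p x * cos (l * x))"]
      unfolding C_def by linarith
    then have poly: "\<bar>integral {a..b} (\<lambda>x. p x * cos (l * x))\<bar> \<le> C / l"
      using \<open>l > 0\<close> by (simp add: field_simps)
    have "integral {a..b} (\<lambda>x. f x * cos (l * x)) - integral {a..b} (\<lambda>x. p x * cos (l * x))
        = integral {a..b} (\<lambda>x. (f x - p x) * cos (l * x))"
      by (subst integral_diff[symmetric])
         (auto intro!: integrable_continuous_real continuous_intros f simp: algebra_simps)
    moreover have "norm (integral {a..b} (\<lambda>x. (f x - p x) * cos (l * x))) \<le> d * (b - a)"
    proof (rule integral_bound[OF \<open>a \<le> b\<close>])
      fix x assume "x \<in> {a..b}"
      then have "\<bar>f x - p x\<bar> \<le> d" using p(2) by (simp add: less_imp_le)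
      moreover have "\<bar>f x - p x\<bar> * \<bar>cos (l * x)\<bar> \<le> \<bar>f x - p x\<bar>"
        by (simp add: mult_left_le)
      ultimately show "norm ((f x - p x) * cos (l * x)) \<le> d"
        by (simp add: abs_mult)
    qed (intro continuous_intros f)
    moreover have "d * (b - a) \<le> e / 2"
      using \<open>e > 0\<close> \<open>a \<le> b\<close> by (simp add: d_def field_simps)
    ultimately show ?thesis using poly by (simp add: abs_le_iff)
  qed
  have "((\<lambda>l. C / l) \<longlongrightarrow> 0) at_top"
    by (rule tendsto_divide_0[OF tendsto_const filterlim_at_top_imp_at_infinity[OF filterlim_ident]])
  then have "eventually (\<lambda>l. \<bar>C / l\<bar> < e / 2) at_top"
    using \<open>e > 0\<close> by (auto dest!: tendstoD[of _ _ _ "e / 2"])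
  then show "eventually (\<lambda>l. dist (integral {a..b} (\<lambda>x. f x * cos (l * x))) 0 < e) at_top"
    using eventually_gt_at_top[of 0]
  proof eventually_elim
    case (elim l)
    then show ?case using small[of l] unfolding dist_real_def diff_zero by linarith
  qed
qed

section \<open>The cosine integral as a Fourier coefficient of the digamma function\<close>

text \<open>
  The substitution \<open>t = w (x + j + 1)\<close>, under which \<open>cos t = cos (w x)\<close> because
  \<open>w\<close> is a multiple of \<open>2 \<pi>\<close>. The right-hand side is the increment of a cosine
  coefficient of the digamma function under a shift of the argument by one.
\<close>

lemma integral_cos_over_period:
  fixes m j :: nat
  defines "w \<equiv> 2 * pi * real (Suc m)"
  shows "integral {w * real (Suc j)..w * real (Suc (Suc j))} (\<lambda>t. cos t / t)
       = integral {0..1} (\<lambda>x. cos (w * x) / (x + real (Suc j)))"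
proof -
  have "w > 0" by (simp add: w_def)
  let ?h = "\<lambda>x. w * (x + real (Suc j))"
  have cosh: "cos (?h x) = cos (w * x)" for x
  proof -
    have "?h x = w * x + 2 * pi * of_int (int (Suc m * Suc j))"
      by (simp add: w_def algebra_simps)
    moreover have "cos (2 * pi * of_int (int (Suc m * Suc j))) = 1"
      "sin (2 * pi * of_int (int (Suc m * Suc j))) = 0"
      using cos_int_2pin sin_int_2pin by blast+
    ultimately show ?thesis by (simp only: cos_add)
  qed
  have "continuous_on {?h 0..?h 1} (\<lambda>t. cos t / t)"
  proof (intro continuous_intros ballI)
    fix t assume "t \<in> {?h 0..?h 1}"
    then have "t \<ge> ?h 0" by simp
    moreover have "?h 0 > 0" using \<open>w > 0\<close> by (intro mult_pos_pos) auto
    ultimately show "t \<noteq> 0" by linarith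
  qed
  then have "((\<lambda>x. w *\<^sub>R (cos (?h x) / ?h x)) has_integral
      integral {?h 0..?h 1} (\<lambda>t. cos t / t)) {0..1}"
    using \<open>w > 0\<close>
    by (intro has_integral_substitution[where c = "?h 0" and d = "?h 1"])
       (auto intro!: continuous_intros derivative_eq_intros mult_left_mono simp del: of_nat_Suc)
  moreover have "w *\<^sub>R (cos (?h x) / ?h x) = cos (w * x) / (x + real (Suc j))" for x
    using \<open>w > 0\<close> unfolding cosh by simp
  ultimately show ?thesis
    by (simp add: integral_unique add_ac)
qed

lemma continuous_on_Digamma_shift [continuous_intros]:
  "c > 0 \<Longrightarrow> continuous_on {0..1} (\<lambda>x::real. Digamma (x + c))"
  by (rule continuous_on_compose2[OF continuous_on_Polygamma[of "{0<..}"]])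
     (auto intro!: continuous_intros elim!: nonpos_Ints_cases)

lemma integral_Digamma_cos_shift:
  fixes m N :: nat
  defines "w \<equiv> 2 * pi * real (Suc m)"
  shows "integral {0..1} (\<lambda>x. Digamma (x + real (Suc N)) * cos (w * x))
       = integral {0..1} (\<lambda>x. Digamma (x + 1) * cos (w * x))
         + integral {w..w * real (Suc N)} (\<lambda>t. cos t / t)"
proof (induction N)
  case 0
  show ?case by simp
next
  case (Suc N)
  have "w > 0" by (simp add: w_def)
  have "integral {0..1} (\<lambda>x. Digamma (x + real (Suc (Suc N))) * cos (w * x))
      = integral {0..1} (\<lambda>x. Digamma (x + real (Suc N)) * cos (w * x) + cos (w * x) / (x + real (Suc N)))"
  proof (rule integral_cong)
    fix x :: real assume "x \<in> {0..1}"
    then have "Digamma (x + real (Suc N) + 1) = Digamma (x + real (Suc N)) + 1 / (x + real (Suc N))"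
      by (intro Digamma_plus1) auto
    then show "Digamma (x + real (Suc (Suc N))) * cos (w * x)
        = Digamma (x + real (Suc N)) * cos (w * x) + cos (w * x) / (x + real (Suc N))"
      by (simp add: algebra_simps)
  qed
  also have "\<dots> = integral {0..1} (\<lambda>x. Digamma (x + real (Suc N)) * cos (w * x))
      + integral {0..1} (\<lambda>x. cos (w * x) / (x + real (Suc N)))"
    by (intro integral_add integrable_continuous_real continuous_intros) auto
  also have "integral {0..1} (\<lambda>x. cos (w * x) / (x + real (Suc N)))
      = integral {w * real (Suc N)..w * real (Suc (Suc N))} (\<lambda>t. cos t / t)"
    unfolding w_def by (rule integral_cos_over_period[symmetric])
  also have "integral {0..1} (\<lambda>x. Digamma (x + real (Suc N)) * cos (w * x)) + \<dots>
      = integral {0..1} (\<lambda>x. Digamma (x + 1) * cos (w * x))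
        + (integral {w..w * real (Suc N)} (\<lambda>t. cos t / t)
           + integral {w * real (Suc N)..w * real (Suc (Suc N))} (\<lambda>t. cos t / t))"
    using Suc.IH by simp
  also have "integral {w..w * real (Suc N)} (\<lambda>t. cos t / t)
      + integral {w * real (Suc N)..w * real (Suc (Suc N))} (\<lambda>t. cos t / t)
      = integral {w..w * real (Suc (Suc N))} (\<lambda>t. cos t / t)"
    using \<open>w > 0\<close>
    by (intro Henstock_Kurzweil_Integration.integral_combine integrable_continuous_real continuous_intros)
       (auto simp: algebra_simps)
  finally show ?case .
qed

lemma integral_cos_multiple_of_2pi:
  "integral {0..1} (\<lambda>x. cos (2 * pi * real (Suc m) * x)) = 0"
proof -
  define w where "w = 2 * pi * real (Suc m)"
  have "w > 0" by (simp add: w_def)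
  have "((\<lambda>x. cos (w * x)) has_integral (sin (w * 1) / w - sin (w * 0) / w)) {0..1}"
    using \<open>w > 0\<close>
    by (intro fundamental_theorem_of_calculus)
       (auto intro!: derivative_eq_intros simp: has_real_derivative_iff_has_vector_derivative[symmetric])
  moreover have "sin w = 0"
    unfolding w_def using sin_int_2pin[of "int (Suc m)"] by simp
  ultimately show ?thesis by (simp add: integral_unique w_def)
qed

text \<open>
  The cosine has mean zero, so subtracting the constant \<open>\<psi>(N + 1)\<close> does not change the
  integral. By monotonicity the difference is then at most
  \<open>\<psi>(N + 2) - \<psi>(N + 1) = 1 / (N + 1)\<close>.
\<close>

lemma abs_integral_Digamma_cos_le:
  "\<bar>integral {0..1} (\<lambda>x. Digamma (x + real (Suc N)) * cos (2 * pi * real (Suc m) * x))\<bar> \<le> 1 / real (Suc N)"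
proof -
  let ?w = "2 * pi * real (Suc m)" and ?D = "Digamma (real (Suc N))"
  have "integral {0..1} (\<lambda>x. (Digamma (x + real (Suc N)) - ?D) * cos (?w * x))
      = integral {0..1} (\<lambda>x. Digamma (x + real (Suc N)) * cos (?w * x) - ?D * cos (?w * x))"
    by (simp add: algebra_simps)
  also have "\<dots> = integral {0..1} (\<lambda>x. Digamma (x + real (Suc N)) * cos (?w * x))
      - integral {0..1} (\<lambda>x. ?D * cos (?w * x))"
    by (intro integral_diff integrable_continuous_real continuous_intros) auto
  also have "integral {0..1} (\<lambda>x. ?D * cos (?w * x)) = 0"
    by (subst integral_mult_right) (use integral_cos_multiple_of_2pi in simp)
  finally have eq: "integral {0..1} (\<lambda>x. (Digamma (x + real (Suc N)) - ?D) * cos (?w * x))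
      = integral {0..1} (\<lambda>x. Digamma (x + real (Suc N)) * cos (?w * x))" by simp
  have "norm (integral {0..1} (\<lambda>x. (Digamma (x + real (Suc N)) - ?D) * cos (?w * x)))
      \<le> 1 / real (Suc N) * (1 - 0)"
  proof (rule integral_bound)
    fix x :: real assume x: "x \<in> {0..1}"
    have "Digamma (x + real (Suc N)) \<le> Digamma (real (Suc N) + 1)"
      using x by (intro Digamma_real_mono) auto
    also have "\<dots> = ?D + 1 / real (Suc N)"
      by (rule Digamma_plus1) auto
    finally have "Digamma (x + real (Suc N)) - ?D \<le> 1 / real (Suc N)" by simp
    moreover have "?D \<le> Digamma (x + real (Suc N))"
      using x by (intro Digamma_real_mono) auto
    moreover have "\<bar>Digamma (x + real (Suc N)) - ?D\<bar> * \<bar>cos (?w * x)\<bar> \<le> \<bar>Digamma (x + real (Suc N)) - ?D\<bar>"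
      by (rule mult_left_le) auto
    ultimately show "norm ((Digamma (x + real (Suc N)) - ?D) * cos (?w * x)) \<le> 1 / real (Suc N)"
      unfolding real_norm_def abs_mult by linarith
  qed (auto intro!: continuous_intros)
  then show ?thesis unfolding eq by simp
qed

text \<open>
  The shift formula and the decay estimate give the limit of the integral of \<open>cos t / t\<close> only along upper
  bounds that are multiples of \<open>w\<close>. An arbitrary bound \<open>T\<close> exceeds the largest such
  multiple below it by less than \<open>w\<close>, and there the integrand is \<open>O(1 / T)\<close>.
\<close>

lemma Ci_eq_integral_Digamma_cos:
  "Ci (2 * pi * real (Suc m)) = integral {0..1} (\<lambda>x. Digamma (x + 1) * cos (2 * pi * real (Suc m) * x))"
proof -
  define w where "w = 2 * pi * real (Suc m)"
  define J where "J = integral {0..1} (\<lambda>x. Digamma (x + 1) * cos (w * x))"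
  have "w > 0" by (simp add: w_def)
  have bound: "\<bar>integral {w..T} (\<lambda>t. cos t / t) + J\<bar> \<le> 2 / (T / w - 1)" if "T > 2 * w" for T
  proof -
    (* the multiple w * (N + 1) is the largest one not exceeding T *)
    define N where "N = nat \<lfloor>T / w\<rfloor> - 1"
    have "T / w > 2" using that \<open>w > 0\<close> by (simp add: field_simps)
    then have N: "real (Suc N) = of_int \<lfloor>T / w\<rfloor>"
      unfolding N_def by linarith
    have N1: "real (Suc N) \<le> T / w" and N2: "T / w < real (Suc N) + 1"
      unfolding N by linarith+
    have pos: "w * real (Suc N) > 0"
      using \<open>w > 0\<close> by (intro mult_pos_pos) auto
    have wN: "w \<le> w * real (Suc N)" "w * real (Suc N) \<le> T" "T - w * real (Suc N) \<le> w"
      using \<open>w > 0\<close> N1 N2 by (simp_all add: field_simps)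
    have "norm (integral {w * real (Suc N)..T} (\<lambda>t. cos t / t))
        \<le> 1 / (w * real (Suc N)) * (T - w * real (Suc N))"
    proof (rule integral_bound)
      fix t assume t: "t \<in> {w * real (Suc N)..T}"
      then have "\<bar>cos t\<bar> / t \<le> 1 / (w * real (Suc N))"
        using pos by (intro frac_le) auto
      then show "norm (cos t / t) \<le> 1 / (w * real (Suc N))"
        using t pos by (simp add: abs_divide)
    qed (use pos wN in \<open>auto intro!: continuous_intros\<close>)
    also have "\<dots> \<le> 1 / (w * real (Suc N)) * w"
      using wN pos by (intro mult_left_mono) auto
    also have "\<dots> = 1 / real (Suc N)" using \<open>w > 0\<close> by simp
    finally have tail: "\<bar>integral {w * real (Suc N)..T} (\<lambda>t. cos t / t)\<bar> \<le> 1 / real (Suc N)" by simp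
    have "integral {w..w * real (Suc N)} (\<lambda>t. cos t / t) + integral {w * real (Suc N)..T} (\<lambda>t. cos t / t)
        = integral {w..T} (\<lambda>t. cos t / t)"
      using \<open>w > 0\<close> wN
      by (intro Henstock_Kurzweil_Integration.integral_combine integrable_continuous_real continuous_intros) auto
    moreover have "\<bar>J + integral {w..w * real (Suc N)} (\<lambda>t. cos t / t)\<bar> \<le> 1 / real (Suc N)"
      using abs_integral_Digamma_cos_le[of N m] integral_Digamma_cos_shift[of N m]
      by (simp add: J_def w_def)
    ultimately have "\<bar>integral {w..T} (\<lambda>t. cos t / t) + J\<bar> \<le> 2 / real (Suc N)"
      using tail by linarith
    also have "\<dots> \<le> 2 / (T / w - 1)"
      using \<open>T / w > 2\<close> N2 by (intro frac_le) auto
    finally show ?thesis .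
  qed
  have "((\<lambda>T. integral {w..T} (\<lambda>t. cos t / t) + J) \<longlongrightarrow> 0) at_top"
  proof (rule Lim_null_comparison)
    show "eventually (\<lambda>T. norm (integral {w..T} (\<lambda>t. cos t / t) + J) \<le> 2 / (T / w - 1)) at_top"
      using eventually_gt_at_top[of "2 * w"] by eventually_elim (use bound in simp)
    have "filterlim (\<lambda>T. (1 / w) * T) at_top at_top"
      using \<open>w > 0\<close> by (intro filterlim_tendsto_pos_mult_at_top[OF tendsto_const _ filterlim_ident]) auto
    then have "filterlim (\<lambda>T. -1 + (1 / w) * T) at_top at_top"
      by (intro filterlim_tendsto_add_at_top[OF tendsto_const])
    then have "filterlim (\<lambda>T. T / w - 1) at_infinity at_top"
      by (intro filterlim_at_top_imp_at_infinity) (simp add: algebra_simps)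
    then show "((\<lambda>T. 2 / (T / w - 1)) \<longlongrightarrow> 0) at_top"
      by (rule tendsto_divide_0[OF tendsto_const])
  qed
  then have "((\<lambda>T. integral {w..T} (\<lambda>t. cos t / t)) \<longlongrightarrow> - J) at_top"
    using tendsto_add[of _ 0 at_top "\<lambda>_. - J" "- J"] by fastforce
  then have "Lim at_top (\<lambda>T. integral {w..T} (\<lambda>t. cos t / t)) = - J"
    by (intro tendsto_Lim) auto
  then show ?thesis by (simp add: Ci_def J_def w_def)
qed

text \<open>
  The boundary terms of the integration by parts vanish because \<open>\<Gamma>(1) = \<Gamma>(2) = 1\<close>.
\<close>

lemma integral_ln_Gamma_sin:
  "integral {0..1} (\<lambda>x. ln_Gamma (x + 1) * sin (2 * pi * real (Suc m) * x))
     = Ci (2 * pi * real (Suc m)) / (2 * pi * real (Suc m))"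
proof -
  define w where "w = 2 * pi * real (Suc m)"
  have "w > 0" by (simp add: w_def)
  have "integral {0..1} (\<lambda>x. ln_Gamma (x + 1) * (w * sin (w * x)))
      = ln_Gamma (1 + 1) * (- cos (w * 1)) - ln_Gamma (0 + 1) * (- cos (w * 0))
        - integral {0..1} (\<lambda>x. Digamma (x + 1) * (- cos (w * x)))"
    by (rule integral_by_parts_continuous)
       (auto intro!: derivative_eq_intros continuous_intros)
  also have "\<dots> = integral {0..1} (\<lambda>x. Digamma (x + 1) * cos (w * x))"
    by (simp add: ln_Gamma_real_pos Gamma_numeral)
  also have "\<dots> = Ci w"
    unfolding w_def by (rule Ci_eq_integral_Digamma_cos[symmetric])
  finally have "w * integral {0..1} (\<lambda>x. ln_Gamma (x + 1) * sin (w * x)) = Ci w"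
    by (subst integral_mult_right[symmetric]) (simp add: mult_ac)
  then show ?thesis
    using \<open>w > 0\<close> unfolding w_def[symmetric] by (simp add: field_simps)
qed

section \<open>Expansion of the cotangent into sines\<close>

text \<open>
  Summation of the conjugate Dirichlet kernel: multiplied by \<open>sin y\<close>, the sum telescopes.
\<close>

lemma cot_eq_sum_sin:
  fixes y :: real
  assumes "sin y \<noteq> 0"
  shows "cot y = (\<Sum>n<M. 2 * sin (2 * real (Suc n) * y)) + cos ((2 * real M + 1) * y) / sin y"
proof (induction M)
  case 0
  show ?case by (simp add: cot_def)
next
  case (Suc M)
  have "cos ((2 * real M + 1) * y) - cos ((2 * real (Suc M) + 1) * y) = 2 * sin (2 * real (Suc M) * y) * sin y"
    using cos_add[of "2 * real (Suc M) * y" y] cos_diff[of "2 * real (Suc M) * y" y]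
    by (simp add: algebra_simps)
  then have "cos ((2 * real M + 1) * y) / sin y
      = 2 * sin (2 * real (Suc M) * y) + cos ((2 * real (Suc M) + 1) * y) / sin y"
    using assms by (simp add: field_simps)
  then show ?case using Suc.IH by simp
qed

text \<open>
  L'Hopital's rule at simple zeros: divide numerator and denominator by \<open>x - a\<close>.
\<close>

lemma tendsto_quotient_of_zeros:
  fixes f h :: "real \<Rightarrow> real"
  assumes "(f has_real_derivative f') (at a)" "(h has_real_derivative h') (at a)"
    and "f a = 0" "h a = 0" "h' \<noteq> 0"
  shows "((\<lambda>x. f x / h x) \<longlongrightarrow> f' / h') (at a)"
proof -
  have "((\<lambda>x. (f x / (x - a)) / (h x / (x - a))) \<longlongrightarrow> f' / h') (at a)"
    using assms by (intro tendsto_divide) (simp_all add: has_field_derivative_iff)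
  moreover have "eventually (\<lambda>x. (f x / (x - a)) / (h x / (x - a)) = f x / h x) (at a)"
    by (auto simp: eventually_at_filter)
  ultimately show ?thesis
    by (rule Lim_transform_eventually)
qed

lemma sin_pi_pos: "0 < x \<Longrightarrow> x < 1 \<Longrightarrow> sin (pi * x) > 0"
  by (rule sin_gt_zero) auto

lemma ln_Gamma_over_sin_extends:
  obtains g :: "real \<Rightarrow> real" where "continuous_on {0..1} g"
    and "\<And>x. 0 < x \<Longrightarrow> x < 1 \<Longrightarrow> g x = ln_Gamma (x + 1) / sin (pi * x)"
proof
  let ?q = "\<lambda>x::real. ln_Gamma (x + 1) / sin (pi * x)"
  define g where "g = ?q(0 := Digamma 1 / pi, 1 := Digamma 2 / - pi)"
  have g_eq: "eventually (\<lambda>y. ?q y = g y) (at x)" for x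
    using eventually_neq_at_within[of 0 x UNIV] eventually_neq_at_within[of 1 x UNIV]
    by eventually_elim (simp add: g_def)
  have "(?q \<longlongrightarrow> g 0) (at 0)"
  proof -
    have "(?q \<longlongrightarrow> Digamma 1 / pi) (at 0)"
      by (rule tendsto_quotient_of_zeros)
         (auto intro!: derivative_eq_intros simp: ln_Gamma_real_pos)
    then show ?thesis by (simp add: g_def)
  qed
  moreover have "(?q \<longlongrightarrow> g 1) (at 1)"
  proof -
    have "(?q \<longlongrightarrow> Digamma 2 / - pi) (at 1)"
      by (rule tendsto_quotient_of_zeros)
         (auto intro!: derivative_eq_intros simp: ln_Gamma_real_pos Gamma_numeral)
    then show ?thesis by (simp add: g_def)
  qed
  moreover have "(?q \<longlongrightarrow> g x) (at x)" if "0 < x" "x < 1" for x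
  proof -
    have "isCont ?q x"
      using that sin_pi_pos[OF that]
      by (intro continuous_intros DERIV_isCont[of "\<lambda>x. ln_Gamma (x + 1)" "Digamma (x + 1)"])
         (auto intro!: derivative_eq_intros)
    then show ?thesis using that by (simp add: g_def isCont_def)
  qed
  ultimately have "(?q \<longlongrightarrow> g x) (at x)" if "x \<in> {0..1}" for x
    using that by (cases "x = 0 \<or> x = 1") auto
  then have "isCont g x" if "x \<in> {0..1}" for x
    unfolding isCont_def using Lim_transform_eventually[OF _ g_eq] that by blast
  then show "continuous_on {0..1} g"
    by (simp add: continuous_at_imp_continuous_on)
  show "g x = ?q x" if "0 < x" "x < 1" for x
    using that by (simp add: g_def)
qed

section \<open>The cotangent integral of log-gamma\<close>

theorem mainTheorem4:
  "(\<lambda>x::real. ln (Gamma (x + 1)) * cot (pi * x)) integrable_on {0..1} \<and>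
   summable (\<lambda>n. Ci (2 * real (Suc n) * pi) / (real (Suc n) * pi)) \<and>
   integral {0..1} (\<lambda>x::real. ln (Gamma (x + 1)) * cot (pi * x)) =
     (\<Sum>n. Ci (2 * real (Suc n) * pi) / (real (Suc n) * pi))"
proof -
  let ?F = "\<lambda>x::real. ln (Gamma (x + 1)) * cot (pi * x)"
  let ?c = "\<lambda>n. Ci (2 * real (Suc n) * pi) / (real (Suc n) * pi)"
  obtain g where g [continuous_intros]: "continuous_on {0..1} g"
    and g_eq: "\<And>x. 0 < x \<Longrightarrow> x < 1 \<Longrightarrow> g x = ln_Gamma (x + 1) / sin (pi * x)"
    using ln_Gamma_over_sin_extends by blast
  define R where "R M = integral {0..1} (\<lambda>x. g x * cos ((2 * real M + 1) * pi * x))" for M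
  have cont_lnG: "continuous_on {0..1} (\<lambda>x::real. ln_Gamma (x + 1))"
    by (intro continuous_at_imp_continuous_on ballI
              DERIV_isCont[of "\<lambda>x. ln_Gamma (x + 1)" "Digamma (_ + 1)"])
       (auto intro!: derivative_eq_intros)
  have F: "(?F has_integral (\<Sum>n<M. ?c n) + R M) {0..1}" for M
  proof -
    have "((\<lambda>x. 2 * (ln_Gamma (x + 1) * sin (2 * pi * real (Suc n) * x))) has_integral ?c n) {0..1}" for n
    proof -
      have "((\<lambda>x. ln_Gamma (x + 1) * sin (2 * pi * real (Suc n) * x)) has_integral
          Ci (2 * pi * real (Suc n)) / (2 * pi * real (Suc n))) {0..1}"
        unfolding integral_ln_Gamma_sin[symmetric]
        by (intro integrable_integral integrable_continuous_real continuous_intros cont_lnG)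
      from has_integral_mult_right[OF this, of 2]
      show ?thesis by (simp add: mult.commute mult.left_commute del: of_nat_Suc)
    qed
    then have "((\<lambda>x. (\<Sum>n<M. 2 * (ln_Gamma (x + 1) * sin (2 * pi * real (Suc n) * x)))
        + g x * cos ((2 * real M + 1) * pi * x)) has_integral (\<Sum>n<M. ?c n) + R M) {0..1}"
      unfolding R_def
      by (intro has_integral_add has_integral_sum integrable_integral
                integrable_continuous_real continuous_intros) auto
    then show ?thesis
    (* at the end points the integrand is 0, as cot is 0 there by division by zero, but g is not *)
    proof (rule has_integral_spike_finite[of "{0, 1}", rotated 2])
      fix x :: real assume "x \<in> {0..1} - {0, 1}"
      then have x: "0 < x" "x < 1" by auto
      have "cot (pi * x) = (\<Sum>n<M. 2 * sin (2 * real (Suc n) * (pi * x)))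
          + cos ((2 * real M + 1) * (pi * x)) / sin (pi * x)"
        using sin_pi_pos[OF x] by (intro cot_eq_sum_sin) auto
      moreover have "ln (Gamma (x + 1)) = ln_Gamma (x + 1)"
        using x by (simp add: ln_Gamma_real_pos)
      ultimately show "?F x = (\<Sum>n<M. 2 * (ln_Gamma (x + 1) * sin (2 * pi * real (Suc n) * x)))
          + g x * cos ((2 * real M + 1) * pi * x)"
        using g_eq[OF x] by (simp add: distrib_left sum_distrib_left mult_ac)
    qed simp
  qed
  have "filterlim (\<lambda>M. pi + 2 * pi * real M) at_top sequentially"
    by (intro filterlim_tendsto_add_at_top[OF tendsto_const] filterlim_real_sequentially
              filterlim_tendsto_pos_mult_at_top[OF tendsto_const]) auto
  then have "filterlim (\<lambda>M. (2 * real M + 1) * pi) at_top sequentially"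
    by (simp add: algebra_simps)
  then have "R \<longlonglongrightarrow> 0"
    unfolding R_def by (intro filterlim_compose[OF Riemann_Lebesgue_cos[OF _ g]]) auto
  then have "(\<lambda>M. integral {0..1} ?F - R M) \<longlonglongrightarrow> integral {0..1} ?F - 0"
    by (intro tendsto_intros)
  moreover have "integral {0..1} ?F - R M = (\<Sum>n<M. ?c n)" for M
    using integral_unique[OF F[of M]] by simp
  ultimately have "?c sums integral {0..1} ?F"
    by (simp add: sums_def)
  then show ?thesis
    using F by (auto simp: sums_iff has_integral_integrable)
qed

end
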